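(* For any Tychonoff space $X$, the following conditions are equivalent: (i) the free topological group $F_G(X)$ is an $F'$-space; (ii) the free Abelian topological group $A_G(X)$ is an $F'$-space; (iii) $X$ is a $P$-space.
   Context: A space is an $F'$-space if any two disjoint cozero sets in it have disjoint closures; it is a $P$-space if every $G_\delta$-set is open. For a Tychonoff space $X$ with a fixed point $x_0$, the (Graev) free topological group $F_G(X)$ is the unique topological group with identity $x_0$ containing $X$ as a subspace such that every continuous map from $X$ to a topological group sending $x_0$ to the identity extends to a continuous homomorphism $F_G(X)\to G$; it does not depend on the choice of $x_0$ up to topological isomorphism. The (Graev) free Abelian topological group $A_G(X)$ is defined analogously with Abelian groups in place of groups. *)

theory Defs
  imports "HOL-Analysis.Analysis" "HOL-Algebra.Free_Abelian_Groups"
begin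

definition topological_group :: "('g, 'm) monoid_scheme \<Rightarrow> 'g topology \<Rightarrow> bool" where
  "topological_group G T \<longleftrightarrow>
     group G \<and> topspace T = carrier G \<and>
     continuous_map (prod_topology T T) T (\<lambda>(x, y). x \<otimes>\<^bsub>G\<^esub> y) \<and>
     continuous_map T T (\<lambda>x. inv\<^bsub>G\<^esub> x)"

definition finest_group_topology ::
    "('g, 'm) monoid_scheme \<Rightarrow> 'a topology \<Rightarrow> ('a \<Rightarrow> 'g) \<Rightarrow> 'g topology" where
  "finest_group_topology G X e =
     topology_generated_by
       (\<Union>{{U. openin T U} | T. topological_group G T \<and> continuous_map X T e})"

text \<open>Letters are pairs (x, True) for x and (x, False) for its inverse.\<close>
fun reduce_word :: "('a \<times> bool) list \<Rightarrow> ('a \<times> bool) list" where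
  "reduce_word [] = []"
| "reduce_word (a # w) =
     (case reduce_word w of
        [] \<Rightarrow> [a]
      | b # v \<Rightarrow> (if fst a = fst b \<and> snd a \<noteq> snd b then v else a # b # v))"

fun reduced_word :: "('a \<times> bool) list \<Rightarrow> bool" where
  "reduced_word [] = True"
| "reduced_word [a] = True"
| "reduced_word (a # b # w) =
     (\<not> (fst a = fst b \<and> snd a \<noteq> snd b) \<and> reduced_word (b # w))"

definition free_group :: "'a set \<Rightarrow> ('a \<times> bool) list monoid" where
  "free_group S =
     \<lparr>carrier = {w. fst ` set w \<subseteq> S \<and> reduced_word w},
      monoid.mult = (\<lambda>u v. reduce_word (u @ v)),
      one = []\<rparr>"

text \<open>Graev: the free group on X minus the base point x0, where x0 is identified
  with the identity.\<close>
definition graev_ins :: "'a \<Rightarrow> 'a \<Rightarrow> ('a \<times> bool) list" where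
  "graev_ins x0 x = (if x = x0 then [] else [(x, True)])"

definition graev_free_group :: "'a topology \<Rightarrow> 'a \<Rightarrow> ('a \<times> bool) list monoid" where
  "graev_free_group X x0 = free_group (topspace X - {x0})"

definition graev_free_topology :: "'a topology \<Rightarrow> 'a \<Rightarrow> ('a \<times> bool) list topology" where
  "graev_free_topology X x0 = finest_group_topology (graev_free_group X x0) X (graev_ins x0)"

definition graev_ab_ins :: "'a \<Rightarrow> 'a \<Rightarrow> 'a \<Rightarrow>\<^sub>0 int" where
  "graev_ab_ins x0 x = (if x = x0 then 0 else frag_of x)"

definition graev_free_ab_group :: "'a topology \<Rightarrow> 'a \<Rightarrow> ('a \<Rightarrow>\<^sub>0 int) monoid" where
  "graev_free_ab_group X x0 = free_Abelian_group (topspace X - {x0})"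

definition graev_free_ab_topology :: "'a topology \<Rightarrow> 'a \<Rightarrow> ('a \<Rightarrow>\<^sub>0 int) topology" where
  "graev_free_ab_topology X x0 =
     finest_group_topology (graev_free_ab_group X x0) X (graev_ab_ins x0)"

definition tychonoff_space :: "'a topology \<Rightarrow> bool" where
  "tychonoff_space X \<longleftrightarrow> completely_regular_space X \<and> t1_space X"

definition cozero_set :: "'a topology \<Rightarrow> 'a set \<Rightarrow> bool" where
  "cozero_set X U \<longleftrightarrow>
     (\<exists>f. continuous_map X euclideanreal f \<and> U = {x \<in> topspace X. f x \<noteq> 0})"

definition F'_space :: "'a topology \<Rightarrow> bool" where
  "F'_space X \<longleftrightarrow>
     (\<forall>U V. cozero_set X U \<and> cozero_set X V \<and> U \<inter> V = {} \<longrightarrow>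
            X closure_of U \<inter> X closure_of V = {})"

definition P_space :: "'a topology \<Rightarrow> bool" where
  "P_space X \<longleftrightarrow> (\<forall>S. gdelta_in X S \<longrightarrow> openin X S)"

end

theory Submission
  imports Defs
begin

text \<open>
  If \<open>X\<close> is a \<open>P\<close>-space, then declaring all \<open>G\<^sub>\<delta>\<close>-sets of the free topological group open yields
  another group topology that makes the insertion of \<open>X\<close> continuous, so by maximality the free
  group is itself a \<open>P\<close>-space, and cozero sets in a \<open>P\<close>-space are clopen.

  Conversely, let \<open>h\<close> be a continuous homomorphism from a topological \<open>F'\<close>-group to the reals. The
  disjoint cozero sets \<open>{h > 0}\<close> and \<open>{h < 0}\<close> are swapped by inversion, so the identity lies in the
  closure of both or of neither; by the \<open>F'\<close>-property it lies in neither, so \<open>h\<close> vanishes near the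
  identity and is locally constant. As every continuous real function on \<open>X\<close> is, up to a constant,
  the restriction of such an \<open>h\<close> on the free group, its zero set is open, and \<open>X\<close> is a \<open>P\<close>-space.
  Only homomorphisms into an Abelian group are used, so \<open>F\<^sub>G(X)\<close> and \<open>A\<^sub>G(X)\<close> are treated alike.
\<close>

section \<open>P-spaces and F'-spaces\<close>

lemma gdelta_in_continuous_map_preimage:
  assumes "continuous_map X Y f" and "gdelta_in Y S"
  shows "gdelta_in X {x \<in> topspace X. f x \<in> S}"
proof -
  obtain C where C_open: "\<And>n::nat. openin Y (C n)" and Inter_C: "\<Inter>(range C) = S"
    using assms(2) unfolding gdelta_in_descending by blast
  have "gdelta_in X (\<Inter>n. {x \<in> topspace X. f x \<in> C n})"
    by (rule gdelta_in_Inter)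
       (auto intro!: open_imp_gdelta_in openin_continuous_map_preimage [OF assms(1)] C_open)
  moreover have "(\<Inter>n. {x \<in> topspace X. f x \<in> C n}) = {x \<in> topspace X. f x \<in> S}"
    using Inter_C by auto
  ultimately show ?thesis by simp
qed

lemma openin_gdelta_preimage_P_space:
  assumes "P_space X" "continuous_map X Y f" "gdelta_in Y S"
  shows "openin X {x \<in> topspace X. f x \<in> S}"
  using assms gdelta_in_continuous_map_preimage unfolding P_space_def by blast

lemma closedin_cozero_set_P_space:
  assumes "P_space X" "cozero_set X U"
  shows "closedin X U"
proof -
  obtain f where f: "continuous_map X euclideanreal f" "U = {x \<in> topspace X. f x \<noteq> 0}"
    using assms(2) unfolding cozero_set_def by blast
  have "gdelta_in euclideanreal {0}"
    by (rule closed_imp_gdelta_in) (auto simp: metrizable_space_euclidean)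
  then have "openin X {x \<in> topspace X. f x \<in> {0}}"
    using assms(1) f(1) by (rule openin_gdelta_preimage_P_space [rotated 2])
  moreover have "topspace X - U = {x \<in> topspace X. f x \<in> {0}}"
    using f(2) by auto
  ultimately show ?thesis
    using f(2) by (auto simp: closedin_def)
qed

lemma P_space_imp_F'_space:
  assumes "P_space X"
  shows "F'_space X"
  unfolding F'_space_def using closedin_cozero_set_P_space [OF assms] by (simp add: closure_of_closedin)

lemma F'_space_closure_of_pos_neg_disjoint:
  assumes "F'_space X" and f: "continuous_map X euclideanreal f"
  shows "X closure_of {x \<in> topspace X. f x > 0} \<inter> X closure_of {x \<in> topspace X. f x < 0} = {}"
proof -
  have "cozero_set X {x \<in> topspace X. f x > 0}"
    unfolding cozero_set_def
    by (rule exI [of _ "\<lambda>x. max (f x) 0"]) (auto intro!: continuous_intros f)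
  moreover have "cozero_set X {x \<in> topspace X. f x < 0}"
    unfolding cozero_set_def
    by (rule exI [of _ "\<lambda>x. min (f x) 0"]) (auto intro!: continuous_intros f)
  moreover have "{x \<in> topspace X. f x > 0} \<inter> {x \<in> topspace X. f x < 0} = {}"
    by auto
  ultimately show ?thesis
    using assms(1) unfolding F'_space_def by blast
qed

lemma continuous_map_suminf:
  fixes f :: "nat \<Rightarrow> 'a \<Rightarrow> 'b::banach"
  assumes cont: "\<And>n. continuous_map X euclidean (f n)"
    and bound: "\<And>n x. x \<in> topspace X \<Longrightarrow> norm (f n x) \<le> M n" and "summable M"
  shows "continuous_map X euclidean (\<lambda>x. suminf (\<lambda>n. f n x))"
proof -
  have unif: "uniform_limit (topspace X) (\<lambda>n x. \<Sum>i<n. f i x) (\<lambda>x. suminf (\<lambda>n. f n x)) sequentially"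
    using bound \<open>summable M\<close> by (rule Weierstrass_m_test)
  have "continuous_map X Met_TC.mtopology (\<lambda>x. suminf (\<lambda>n. f n x))"
  proof (rule Met_TC.continuous_map_uniform_limit)
    show "\<forall>\<^sub>F n in sequentially. continuous_map X Met_TC.mtopology (\<lambda>x. \<Sum>i<n. f i x)"
      by (auto intro!: always_eventually continuous_map_sum cont)
    show "\<forall>\<^sub>F n in sequentially. \<forall>x\<in>topspace X.
            suminf (\<lambda>n. f n x) \<in> UNIV \<and> dist (\<Sum>i<n. f i x) (suminf (\<lambda>n. f n x)) < \<epsilon>" if "\<epsilon> > 0" for \<epsilon>
      using uniform_limitD [OF unif that] by simp
  qed auto
  then show ?thesis by simp
qed

lemma gdelta_separating_sequence:
  assumes "completely_regular_space X" and S: "gdelta_in X S" and "p \<in> S"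
  obtains f :: "nat \<Rightarrow> 'a \<Rightarrow> real" where "\<And>n. continuous_map X euclideanreal (f n)"
    "\<And>n x. x \<in> topspace X \<Longrightarrow> f n x \<in> {0..1}" "\<And>n. f n p = 0"
    "\<And>x. \<lbrakk>x \<in> topspace X; \<And>n. f n x = 0\<rbrakk> \<Longrightarrow> x \<in> S"
proof -
  obtain C where C_open: "\<And>n::nat. openin X (C n)" and Inter_C: "\<Inter>(range C) = S"
    using S unfolding gdelta_in_descending by blast
  have "\<exists>f. continuous_map X (top_of_set {0..1::real}) f \<and> f p = 0 \<and> f ` (topspace X - C n) \<subseteq> {1}"
    for n
    using assms C_open Inter_C gdelta_in_subset [OF S]
    unfolding completely_regular_space_def by (auto simp: closedin_diff)
  then obtain f :: "nat \<Rightarrow> 'a \<Rightarrow> real" where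
    f_cont: "\<And>n. continuous_map X (top_of_set {0..1}) (f n)" and f_p: "\<And>n. f n p = 0" and
    f_outside: "\<And>n. f n ` (topspace X - C n) \<subseteq> {1}"
    by metis
  show thesis
  proof
    show "continuous_map X euclideanreal (f n)" for n
      using f_cont by (simp add: continuous_map_in_subtopology)
    show "f n x \<in> {0..1}" if "x \<in> topspace X" for n x
      using f_cont [of n] that by (auto simp: continuous_map_in_subtopology)
    show "x \<in> S" if x: "x \<in> topspace X" and zero: "\<And>n. f n x = 0" for x
    proof -
      have "x \<in> C n" for n
        using f_outside [of n] x zero [of n] by fastforce
      then show ?thesis
        using Inter_C by blast
    qed
  qed (rule f_p)
qed

lemma zero_set_within_gdelta:
  assumes "completely_regular_space X" "gdelta_in X S" "p \<in> S"
  obtains g :: "'a \<Rightarrow> real"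
    where "continuous_map X euclideanreal g" "g p = 0" "{x \<in> topspace X. g x = 0} \<subseteq> S"
proof -
  obtain f :: "nat \<Rightarrow> 'a \<Rightarrow> real" where f_cont: "\<And>n. continuous_map X euclideanreal (f n)"
    and f_range: "\<And>n x. x \<in> topspace X \<Longrightarrow> f n x \<in> {0..1}" and f_p: "\<And>n. f n p = 0"
    and f_zero: "\<And>x. \<lbrakk>x \<in> topspace X; \<And>n. f n x = 0\<rbrakk> \<Longrightarrow> x \<in> S"
    using gdelta_separating_sequence [OF assms] by metis
  define s where "s n x = (1/2)^n * f n x" for n x
  have s_bound: "norm (s n x) \<le> (1/2)^n" if "x \<in> topspace X" for n x
    using f_range [OF that] by (simp add: s_def abs_mult mult_left_le)
  have geometric: "summable (\<lambda>n. (1/2::real)^n)"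
    by (intro summable_geometric) simp
  show thesis
  proof
    have "continuous_map X euclideanreal (s n)" for n
      unfolding s_def by (intro continuous_intros f_cont)
    then show "continuous_map X euclideanreal (\<lambda>x. suminf (\<lambda>n. s n x))"
      using s_bound geometric by (rule continuous_map_suminf)
    show "suminf (\<lambda>n. s n p) = 0"
      by (simp add: s_def f_p)
    show "{x \<in> topspace X. suminf (\<lambda>n. s n x) = 0} \<subseteq> S"
    proof clarify
      fix x assume x: "x \<in> topspace X" and "suminf (\<lambda>n. s n x) = 0"
      moreover have "summable (\<lambda>n. s n x)"
        using s_bound [OF x] geometric by (rule summable_comparison_test' [rotated])
      moreover have "s n x \<ge> 0" for n
        using f_range [OF x] by (simp add: s_def)
      ultimately have "s n x = 0" for n
        using suminf_eq_zero_iff [of "\<lambda>n. s n x"] by simp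
      then show "x \<in> S"
        using x by (intro f_zero) (simp_all add: s_def)
    qed
  qed
qed

lemma P_space_if_openin_zero_sets:
  assumes "completely_regular_space X"
    and zero_set: "\<And>g. continuous_map X euclideanreal g \<Longrightarrow> openin X {x \<in> topspace X. g x = 0}"
  shows "P_space X"
  unfolding P_space_def
proof (intro allI impI)
  fix S assume S: "gdelta_in X S"
  show "openin X S"
  proof (subst openin_subopen, intro ballI)
    fix p assume p: "p \<in> S"
    then obtain g where g: "continuous_map X euclideanreal g" "g p = 0"
      "{x \<in> topspace X. g x = 0} \<subseteq> S"
      using zero_set_within_gdelta [OF assms(1) S] by metis
    moreover have "p \<in> topspace X"
      using p gdelta_in_subset [OF S] by blast
    ultimately show "\<exists>W. openin X W \<and> p \<in> W \<and> W \<subseteq> S"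
      using zero_set by blast
  qed
qed

section \<open>The topology generated by the G-delta sets\<close>

definition gdelta_topology :: "'a topology \<Rightarrow> 'a topology" where
  "gdelta_topology T = topology_generated_by {S. gdelta_in T S}"

lemma openin_gdelta_topology_if_gdelta_in:
  "gdelta_in T S \<Longrightarrow> openin (gdelta_topology T) S"
  by (simp add: gdelta_topology_def topology_generated_by_Basis)

lemma topspace_gdelta_topology [simp]: "topspace (gdelta_topology T) = topspace T"
  using gdelta_in_subset by (fastforce simp: gdelta_topology_def)

lemma continuous_map_into_gdelta_topology:
  assumes f: "continuous_map Y T f"
    and finer: "\<And>S. gdelta_in Y S \<Longrightarrow> openin Z S" and top: "topspace Z = topspace Y"
  shows "continuous_map Z (gdelta_topology T) f"
  unfolding gdelta_topology_def
proof (rule continuous_on_generated_topo)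
  fix S assume "S \<in> {S. gdelta_in T S}"
  then have "openin Z {x \<in> topspace Y. f x \<in> S}"
    by (intro finer gdelta_in_continuous_map_preimage [OF f]) simp
  also have "{x \<in> topspace Y. f x \<in> S} = f -` S \<inter> topspace Z"
    using top by auto
  finally show "openin Z (f -` S \<inter> topspace Z)" .
next
  show "f ` topspace Z \<subseteq> \<Union>{S. gdelta_in T S}"
    using continuous_map_image_subset_topspace [OF f] top by blast
qed

lemma openin_prod_gdelta_topology:
  assumes "gdelta_in (prod_topology T T') S"
  shows "openin (prod_topology (gdelta_topology T) (gdelta_topology T')) S"
  unfolding openin_prod_topology_alt
proof (intro allI impI)
  obtain C where C_open: "\<And>n::nat. openin (prod_topology T T') (C n)" and Inter_C: "\<Inter>(range C) = S"
    using assms unfolding gdelta_in_descending by blast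
  fix x y assume "(x, y) \<in> S"
  then have "(x, y) \<in> C n" for n
    using Inter_C by blast
  then have "\<exists>A B. openin T A \<and> openin T' B \<and> x \<in> A \<and> y \<in> B \<and> A \<times> B \<subseteq> C n" for n
    using C_open [of n] unfolding openin_prod_topology_alt by blast
  then obtain A B where AB_open: "\<And>n. openin T (A n)" "\<And>n. openin T' (B n)"
    and xy: "\<And>n. x \<in> A n" "\<And>n. y \<in> B n" and box: "\<And>n. A n \<times> B n \<subseteq> C n"
    by metis
  have "gdelta_in T (\<Inter>(range A))" "gdelta_in T' (\<Inter>(range B))"
    by (intro gdelta_in_Inter; auto intro: open_imp_gdelta_in AB_open)+
  moreover have "\<Inter>(range A) \<times> \<Inter>(range B) \<subseteq> S"
    using box Inter_C by blast
  moreover have "x \<in> \<Inter>(range A)" "y \<in> \<Inter>(range B)"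
    using xy by auto
  ultimately show "\<exists>U V. openin (gdelta_topology T) U \<and> openin (gdelta_topology T') V \<and>
                     x \<in> U \<and> y \<in> V \<and> U \<times> V \<subseteq> S"
    using openin_gdelta_topology_if_gdelta_in by metis
qed

section \<open>Topological groups\<close>

lemma topological_groupI:
  assumes "group G" "topspace T = carrier G"
    and "continuous_map (prod_topology T T) T (\<lambda>z. fst z \<otimes>\<^bsub>G\<^esub> snd z)"
    and "continuous_map T T (\<lambda>x. inv\<^bsub>G\<^esub> x)"
  shows "topological_group G T"
  using assms by (simp add: topological_group_def case_prod_beta')

lemma topological_group_imp_group: "topological_group G T \<Longrightarrow> group G"
  by (simp add: topological_group_def)

lemma topspace_topological_group: "topological_group G T \<Longrightarrow> topspace T = carrier G"
  by (simp add: topological_group_def)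

lemma continuous_map_group_mult:
  assumes "topological_group G T" "continuous_map Y T u" "continuous_map Y T v"
  shows "continuous_map Y T (\<lambda>x. u x \<otimes>\<^bsub>G\<^esub> v x)"
proof -
  have "continuous_map Y (prod_topology T T) (\<lambda>x. (u x, v x))"
    using assms(2,3) by (rule continuous_map_pairedI)
  moreover have "continuous_map (prod_topology T T) T (\<lambda>(x, y). x \<otimes>\<^bsub>G\<^esub> y)"
    using assms(1) by (simp add: topological_group_def)
  ultimately show ?thesis
    using continuous_map_compose by (fastforce simp: o_def)
qed

lemma continuous_map_group_inv:
  assumes "topological_group G T" "continuous_map Y T u"
  shows "continuous_map Y T (\<lambda>x. inv\<^bsub>G\<^esub> (u x))"
  using continuous_map_compose [OF assms(2)] assms(1)
  unfolding topological_group_def by (fastforce simp: o_def)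

lemma topological_group_gdelta_topology:
  assumes T: "topological_group G T"
  shows "topological_group G (gdelta_topology T)"
proof (rule topological_groupI)
  show "group G" "topspace (gdelta_topology T) = carrier G"
    using T by (simp_all add: topological_group_def)
  have "continuous_map (prod_topology T T) T (\<lambda>z. fst z \<otimes>\<^bsub>G\<^esub> snd z)"
    by (intro continuous_map_group_mult [OF T] continuous_map_fst continuous_map_snd)
  then show "continuous_map (prod_topology (gdelta_topology T) (gdelta_topology T))
               (gdelta_topology T) (\<lambda>z. fst z \<otimes>\<^bsub>G\<^esub> snd z)"
    by (rule continuous_map_into_gdelta_topology) (simp_all add: openin_prod_gdelta_topology)
  have "continuous_map T T (\<lambda>x. inv\<^bsub>G\<^esub> x)"
    using T by (simp add: topological_group_def)
  then show "continuous_map (gdelta_topology T) (gdelta_topology T) (\<lambda>x. inv\<^bsub>G\<^esub> x)"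
    by (rule continuous_map_into_gdelta_topology) (simp_all add: openin_gdelta_topology_if_gdelta_in)
qed

lemma continuous_map_pullback_topology:
  "continuous_map (pullback_topology A h T) T h"
  using continuous_map_pullback [OF continuous_map_id] by (simp add: o_def)

lemma topological_group_pullback_topology:
  assumes "group G" and H: "topological_group H T" and h: "h \<in> hom G H"
  shows "topological_group G (pullback_topology (carrier G) h T)" (is "topological_group G ?T")
proof (rule topological_groupI)
  interpret group_hom G H h
    using \<open>group G\<close> topological_group_imp_group [OF H] h
    by (intro group_hom.intro group_hom_axioms.intro)
  show top: "topspace ?T = carrier G"
    by (auto simp: topspace_pullback_topology topspace_topological_group [OF H])
  note h_cont = continuous_map_pullback_topology [of "carrier G" h T]
  have "continuous_map (prod_topology ?T ?T) T (\<lambda>z. h (fst z) \<otimes>\<^bsub>H\<^esub> h (snd z))"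
    by (intro continuous_map_group_mult [OF H] continuous_map_compose [OF _ h_cont, unfolded o_def]
        continuous_map_fst continuous_map_snd)
  then have "continuous_map (prod_topology ?T ?T) T (h \<circ> (\<lambda>z. fst z \<otimes>\<^bsub>G\<^esub> snd z))"
    by (rule continuous_map_eq) (auto simp: top)
  then show "continuous_map (prod_topology ?T ?T) ?T (\<lambda>z. fst z \<otimes>\<^bsub>G\<^esub> snd z)"
    by (rule continuous_map_pullback') (auto simp: top)
  have "continuous_map ?T T (h \<circ> (\<lambda>x. inv\<^bsub>G\<^esub> x))"
    by (rule continuous_map_eq [OF continuous_map_group_inv [OF H h_cont]]) (simp add: top)
  then show "continuous_map ?T ?T (\<lambda>x. inv\<^bsub>G\<^esub> x)"
    by (rule continuous_map_pullback') (auto simp: top)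
qed (rule \<open>group G\<close>)

definition additive_group :: "'a::group_add monoid" where
  "additive_group = \<lparr>carrier = UNIV, monoid.mult = (+), one = 0\<rparr>"

lemma additive_group_simps [simp]:
  "carrier additive_group = UNIV" "x \<otimes>\<^bsub>additive_group\<^esub> y = x + y" "\<one>\<^bsub>additive_group\<^esub> = 0"
  by (simp_all add: additive_group_def)

lemma group_additive_group: "group (additive_group :: 'a::group_add monoid)"
proof (rule groupI)
  show "\<exists>y\<in>carrier additive_group. y \<otimes>\<^bsub>additive_group\<^esub> x = \<one>\<^bsub>additive_group\<^esub>" for x :: 'a
    by (auto intro: exI [of _ "- x"])
qed (simp_all add: add.assoc)

lemma comm_group_additive_group: "comm_group (additive_group :: 'a::ab_group_add monoid)"
  by (rule group.group_comm_groupI [OF group_additive_group]) (simp add: add.commute)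

lemma inv_additive_group [simp]: "inv\<^bsub>additive_group\<^esub> x = - (x :: 'a::group_add)"
  by (rule group.inv_equality [OF group_additive_group]) simp_all

lemma topological_group_additive_group:
  "topological_group additive_group (euclidean :: 'a::topological_group_add topology)"
proof (rule topological_groupI)
  show "continuous_map (prod_topology euclidean euclidean) euclidean
          (\<lambda>z. fst z \<otimes>\<^bsub>additive_group\<^esub> (snd z :: 'a))"
    by (auto intro!: continuous_intros)
  show "continuous_map euclidean euclidean (\<lambda>x :: 'a. inv\<^bsub>additive_group\<^esub> x)"
    by (auto intro!: continuous_intros)
qed (simp_all add: group_additive_group)

lemma F'_space_hom_eq_0_near_one:
  fixes h :: "'g \<Rightarrow> real"
  assumes T: "topological_group G T" and "F'_space T"
    and hom: "h \<in> hom G additive_group" and cont: "continuous_map T euclideanreal h"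
  obtains W where "openin T W" "\<one>\<^bsub>G\<^esub> \<in> W" "\<And>x. x \<in> W \<Longrightarrow> h x = 0"
proof -
  interpret group_hom G additive_group h
    using topological_group_imp_group [OF T] group_additive_group hom
    by (intro group_hom.intro group_hom_axioms.intro)
  note top = topspace_topological_group [OF T]
  let ?i = "\<lambda>x. inv\<^bsub>G\<^esub> x"
  let ?P = "{x \<in> topspace T. h x > 0}" and ?N = "{x \<in> topspace T. h x < 0}"
  have "continuous_map T T ?i"
    using continuous_map_group_inv [OF T continuous_map_id] by simp
  then have inv_closure: "?i x \<in> T closure_of B" if "x \<in> T closure_of A" "?i ` A \<subseteq> B" for x A B
    using that continuous_map_image_closure_subset [of T T ?i A] closure_of_mono [of "?i ` A" B T]
    by blast
  have "?i ` ?P \<subseteq> ?N" "?i ` ?N \<subseteq> ?P"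
    by (auto simp: top)
  then have "\<one>\<^bsub>G\<^esub> \<in> T closure_of ?P \<longleftrightarrow> \<one>\<^bsub>G\<^esub> \<in> T closure_of ?N"
    using inv_closure [of "\<one>\<^bsub>G\<^esub>"] by auto
  then have one: "\<one>\<^bsub>G\<^esub> \<notin> T closure_of ?P" "\<one>\<^bsub>G\<^esub> \<notin> T closure_of ?N"
    using F'_space_closure_of_pos_neg_disjoint [OF \<open>F'_space T\<close> cont] by blast+
  show thesis
  proof
    show "openin T (topspace T - (T closure_of ?P \<union> T closure_of ?N))"
      by (intro openin_diff closedin_Un closedin_closure_of) simp
    show "\<one>\<^bsub>G\<^esub> \<in> topspace T - (T closure_of ?P \<union> T closure_of ?N)"
      using one by (simp add: top)
    show "h x = 0" if "x \<in> topspace T - (T closure_of ?P \<union> T closure_of ?N)" for x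
      using that closure_of_subset [of ?P T] closure_of_subset [of ?N T] by fastforce
  qed
qed

lemma openin_hom_level_set_F'_space:
  fixes h :: "'g \<Rightarrow> real"
  assumes T: "topological_group G T" and "F'_space T"
    and hom: "h \<in> hom G additive_group" and "continuous_map T euclideanreal h"
  shows "openin T {x \<in> topspace T. h x = c}"
proof (subst openin_subopen, intro ballI)
  interpret group_hom G additive_group h
    using topological_group_imp_group [OF T] group_additive_group hom
    by (intro group_hom.intro group_hom_axioms.intro)
  note top = topspace_topological_group [OF T]
  obtain W where W: "openin T W" "\<one>\<^bsub>G\<^esub> \<in> W" "\<And>x. x \<in> W \<Longrightarrow> h x = 0"
    using F'_space_hom_eq_0_near_one [OF assms] by metis
  fix y assume y: "y \<in> {x \<in> topspace T. h x = c}"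
  then have y_carrier: "y \<in> carrier G"
    by (simp add: top)
  let ?V = "{x \<in> topspace T. x \<otimes>\<^bsub>G\<^esub> inv\<^bsub>G\<^esub> y \<in> W}"
  have "continuous_map T T (\<lambda>x. x \<otimes>\<^bsub>G\<^esub> inv\<^bsub>G\<^esub> y)"
    using y_carrier by (intro continuous_map_group_mult [OF T]) (auto simp: top)
  then have "openin T ?V"
    using W(1) by (rule openin_continuous_map_preimage)
  moreover have "y \<in> ?V"
    using W(2) y_carrier by (simp add: top)
  moreover have "h x = c" if "x \<in> ?V" for x
    using that W(3) [of "x \<otimes>\<^bsub>G\<^esub> inv\<^bsub>G\<^esub> y"] y y_carrier by (simp add: top)
  ultimately show "\<exists>V. openin T V \<and> y \<in> V \<and> V \<subseteq> {x \<in> topspace T. h x = c}"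
    using openin_subset by blast
qed

section \<open>Suprema of group topologies\<close>

definition Sup_topology :: "'a topology set \<Rightarrow> 'a topology" where
  "Sup_topology \<T> = topology_generated_by (\<Union>T\<in>\<T>. {U. openin T U})"

lemma openin_Sup_topology:
  "\<lbrakk>T \<in> \<T>; openin T U\<rbrakk> \<Longrightarrow> openin (Sup_topology \<T>) U"
  by (auto simp: Sup_topology_def intro: topology_generated_by_Basis)

lemma topspace_Sup_topology: "topspace (Sup_topology \<T>) = (\<Union>T\<in>\<T>. topspace T)"
  using openin_topspace openin_subset by (fastforce simp: Sup_topology_def)

lemma continuous_map_into_Sup_topology:
  assumes "\<T> \<noteq> {}" "\<And>T. T \<in> \<T> \<Longrightarrow> continuous_map Y T f"
  shows "continuous_map Y (Sup_topology \<T>) f"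
  unfolding Sup_topology_def
proof (rule continuous_on_generated_topo)
  show "openin Y (f -` U \<inter> topspace Y)" if "U \<in> (\<Union>T\<in>\<T>. {U. openin T U})" for U
    using that assms(2) by (auto simp: continuous_map_alt)
  show "f ` topspace Y \<subseteq> \<Union>(\<Union>T\<in>\<T>. {U. openin T U})"
    using assms continuous_map_image_subset_topspace by fastforce
qed

lemma continuous_map_from_Sup_topology:
  assumes "T \<in> \<T>" "topspace T = topspace (Sup_topology \<T>)" "continuous_map T Y f"
  shows "continuous_map (Sup_topology \<T>) Y f"
  using assms openin_Sup_topology [OF assms(1)] by (simp add: continuous_map_def)

lemma topological_group_Sup_topology:
  assumes nonempty: "\<T> \<noteq> {}" and \<T>: "\<And>T. T \<in> \<T> \<Longrightarrow> topological_group G T"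
  shows "topological_group G (Sup_topology \<T>)" (is "topological_group G ?S")
proof (rule topological_groupI)
  show "group G"
    using assms topological_group_imp_group by blast
  show top: "topspace ?S = carrier G"
    using assms topspace_topological_group by (fastforce simp: topspace_Sup_topology)
  have id: "continuous_map ?S T (\<lambda>x. x)" if "T \<in> \<T>" for T
    using that \<T> by (intro continuous_map_from_Sup_topology [of T])
      (simp_all add: top topspace_topological_group [of G])
  show "continuous_map (prod_topology ?S ?S) ?S (\<lambda>z. fst z \<otimes>\<^bsub>G\<^esub> snd z)"
    using nonempty
  proof (rule continuous_map_into_Sup_topology)
    show "continuous_map (prod_topology ?S ?S) T (\<lambda>z. fst z \<otimes>\<^bsub>G\<^esub> snd z)" if "T \<in> \<T>" for T
      by (intro continuous_map_group_mult [OF \<T> [OF that]] continuous_map_fst continuous_map_snd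
          continuous_map_compose [OF _ id [OF that], unfolded o_def])
  qed
  show "continuous_map ?S ?S (\<lambda>x. inv\<^bsub>G\<^esub> x)"
    using nonempty
  proof (rule continuous_map_into_Sup_topology)
    show "continuous_map ?S T (\<lambda>x. inv\<^bsub>G\<^esub> x)" if "T \<in> \<T>" for T
      using \<T> [OF that] id [OF that] by (rule continuous_map_group_inv)
  qed
qed

section \<open>The finest group topology\<close>

lemma finest_group_topology_eq_Sup_topology:
  "finest_group_topology G X e = Sup_topology {T. topological_group G T \<and> continuous_map X T e}"
  by (simp add: finest_group_topology_def Sup_topology_def image_Collect)

lemma openin_finest_group_topology:
  assumes "topological_group G T" "continuous_map X T e" "openin T U"
  shows "openin (finest_group_topology G X e) U"
  using assms by (auto simp: finest_group_topology_eq_Sup_topology intro: openin_Sup_topology)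

locale group_insertion = group G for G (structure) +
  fixes X :: "'c topology" and e :: "'c \<Rightarrow> 'a"
  assumes insertion_closed: "e \<in> topspace X \<rightarrow> carrier G"
begin

lemma continuous_map_pullback_insertion:
  assumes "continuous_map X T (h \<circ> e)"
  shows "continuous_map X (pullback_topology (carrier G) h T) e"
  using assms by (rule continuous_map_pullback') (use insertion_closed in auto)

text \<open>The pullback along the trivial homomorphism is the indiscrete topology.\<close>
lemma ex_group_topology_insertion_continuous:
  "\<exists>T. topological_group G T \<and> continuous_map X T e"
proof -
  let ?T = "pullback_topology (carrier G) (\<lambda>_. 0 :: real) euclideanreal"
  have "(\<lambda>_. 0 :: real) \<in> hom G additive_group"
    by (simp add: hom_def)
  with is_group topological_group_additive_group have "topological_group G ?T"
    by (rule topological_group_pullback_topology)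
  moreover have "continuous_map X ?T e"
    by (rule continuous_map_pullback_insertion) (simp add: o_def)
  ultimately show ?thesis by blast
qed

lemma topological_group_finest_group_topology:
  "topological_group G (finest_group_topology G X e)"
  unfolding finest_group_topology_eq_Sup_topology
  using ex_group_topology_insertion_continuous by (intro topological_group_Sup_topology) auto

lemma continuous_map_insertion: "continuous_map X (finest_group_topology G X e) e"
  unfolding finest_group_topology_eq_Sup_topology
  using ex_group_topology_insertion_continuous by (intro continuous_map_into_Sup_topology) auto

lemma continuous_map_hom_finest_group_topology:
  assumes "topological_group H T" "h \<in> hom G H" "continuous_map X T (h \<circ> e)"
  shows "continuous_map (finest_group_topology G X e) T h"
proof -
  let ?T = "pullback_topology (carrier G) h T"
  have T: "topological_group G ?T"
    using is_group assms(1,2) by (rule topological_group_pullback_topology)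
  moreover have "topspace ?T = topspace (finest_group_topology G X e)"
    using T topological_group_finest_group_topology by (simp add: topspace_topological_group)
  moreover have "continuous_map X ?T e"
    using assms(3) by (rule continuous_map_pullback_insertion)
  ultimately show ?thesis
    unfolding finest_group_topology_eq_Sup_topology
    by (intro continuous_map_from_Sup_topology [of ?T] continuous_map_pullback_topology) auto
qed

lemma P_space_finest_group_topology:
  assumes X: "P_space X"
  shows "P_space (finest_group_topology G X e)"
  unfolding P_space_def
proof (intro allI impI)
  let ?F = "finest_group_topology G X e"
  fix S assume "gdelta_in ?F S"
  then have "openin (gdelta_topology ?F) S"
    by (rule openin_gdelta_topology_if_gdelta_in)
  moreover have "topological_group G (gdelta_topology ?F)"
    by (intro topological_group_gdelta_topology topological_group_finest_group_topology)
  moreover have "continuous_map X (gdelta_topology ?F) e"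
    using X unfolding P_space_def
    by (intro continuous_map_into_gdelta_topology [OF continuous_map_insertion]) auto
  ultimately show "openin ?F S"
    using openin_finest_group_topology by blast
qed

lemma P_space_if_F'_space_finest_group_topology:
  assumes X: "completely_regular_space X" and base: "e x0 = \<one>"
    and extend: "\<And>f :: 'c \<Rightarrow> real.
      \<exists>h\<in>hom G additive_group. \<forall>x\<in>topspace X - {x0}. h (e x) = f x"
    and F': "F'_space (finest_group_topology G X e)"
  shows "P_space X"
  using X
proof (rule P_space_if_openin_zero_sets)
  let ?F = "finest_group_topology G X e"
  fix f :: "'c \<Rightarrow> real" assume f: "continuous_map X euclideanreal f"
  obtain h where hom: "h \<in> hom G additive_group"
    and h: "\<And>x. x \<in> topspace X - {x0} \<Longrightarrow> h (e x) = f x - f x0"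
    using extend [of "\<lambda>x. f x - f x0"] by blast
  have "h \<one> = 0"
    using hom_one [OF hom is_group group_additive_group] by simp
  then have h_insertion: "h (e x) = f x - f x0" if "x \<in> topspace X" for x
    using h base that by (cases "x = x0") auto
  have "continuous_map X euclideanreal (\<lambda>x. f x - f x0)"
    by (intro continuous_intros f)
  then have "continuous_map X euclideanreal (h \<circ> e)"
    by (rule continuous_map_eq) (simp add: h_insertion)
  then have "continuous_map ?F euclideanreal h"
    using topological_group_additive_group hom by (intro continuous_map_hom_finest_group_topology)
  then have "openin ?F {y \<in> topspace ?F. h y = - f x0}"
    using topological_group_finest_group_topology F' hom by (intro openin_hom_level_set_F'_space)
  with continuous_map_insertion
  have "openin X {x \<in> topspace X. e x \<in> {y \<in> topspace ?F. h y = - f x0}}"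
    by (rule openin_continuous_map_preimage)
  also have "{x \<in> topspace X. e x \<in> {y \<in> topspace ?F. h y = - f x0}} = {x \<in> topspace X. f x = 0}"
    using continuous_map_image_subset_topspace [OF continuous_map_insertion] h_insertion by auto
  finally show "openin X {x \<in> topspace X. f x = 0}" .
qed

lemma F'_space_finest_group_topology_iff_P_space:
  assumes "completely_regular_space X" "e x0 = \<one>"
    and "\<And>f :: 'c \<Rightarrow> real. \<exists>h\<in>hom G additive_group. \<forall>x\<in>topspace X - {x0}. h (e x) = f x"
  shows "F'_space (finest_group_topology G X e) \<longleftrightarrow> P_space X"
  using P_space_if_F'_space_finest_group_topology [OF assms]
    P_space_imp_F'_space P_space_finest_group_topology by blast

end

section \<open>The free group of reduced words\<close>

definition inv_letter :: "'a \<times> bool \<Rightarrow> 'a \<times> bool" where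
  "inv_letter a = (fst a, \<not> snd a)"

lemma inv_letter_inv_letter [simp]: "inv_letter (inv_letter a) = a"
  by (simp add: inv_letter_def)

lemma inv_letter_eq_iff [simp]: "inv_letter a = inv_letter b \<longleftrightarrow> a = b"
  by (metis inv_letter_inv_letter)

lemma eq_inv_letter_iff: "a = inv_letter b \<longleftrightarrow> fst a = fst b \<and> snd a \<noteq> snd b"
  by (auto simp: inv_letter_def prod_eq_iff)

definition cons_reduce :: "'a \<times> bool \<Rightarrow> ('a \<times> bool) list \<Rightarrow> ('a \<times> bool) list" where
  "cons_reduce a w =
     (case w of [] \<Rightarrow> [a] | b # v \<Rightarrow> (if a = inv_letter b then v else a # b # v))"

lemma reduce_word_eq_foldr: "reduce_word w = foldr cons_reduce w []"
  by (induction w)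
     (auto simp: cons_reduce_def [of _ "foldr cons_reduce _ _"] eq_inv_letter_iff split: list.split)

lemma reduce_word_Cons: "reduce_word (a # w) = cons_reduce a (reduce_word w)"
  by (simp add: reduce_word_eq_foldr)

lemma reduce_word_append: "reduce_word (u @ v) = foldr cons_reduce u (reduce_word v)"
  by (simp add: reduce_word_eq_foldr)

lemma set_reduce_word: "set (reduce_word w) \<subseteq> set w"
  by (induction w) (auto split: list.splits if_splits)

lemma reduced_word_Cons_iff:
  "reduced_word (a # w) \<longleftrightarrow> reduced_word w \<and> (w \<noteq> [] \<longrightarrow> a \<noteq> inv_letter (hd w))"
  by (cases w) (auto simp: eq_inv_letter_iff)

lemma reduced_word_cons_reduce: "reduced_word w \<Longrightarrow> reduced_word (cons_reduce a w)"
  by (cases w) (auto simp: cons_reduce_def reduced_word_Cons_iff)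

lemma reduced_word_reduce_word: "reduced_word (reduce_word w)"
  by (induction w) (simp_all add: reduce_word_Cons reduced_word_cons_reduce del: reduce_word.simps(2))

lemma reduce_word_reduced: "reduced_word w \<Longrightarrow> reduce_word w = w"
  by (induction w rule: reduced_word.induct) auto

lemma cons_reduce_inv_letter:
  assumes "reduced_word w"
  shows "cons_reduce a (cons_reduce (inv_letter a) w) = w"
  using assms by (cases w; cases "tl w") (auto simp: cons_reduce_def reduced_word_Cons_iff)

text \<open>
  The two instances are the action of letters on reduced words, which yields associativity, and on
  a group by left multiplication, which yields the universal property.
\<close>
lemma foldr_reduce_word:
  assumes closed: "\<And>a y. \<lbrakk>a \<in> A; y \<in> Y\<rbrakk> \<Longrightarrow> \<phi> a y \<in> Y"
    and cancel: "\<And>a y. \<lbrakk>a \<in> A; y \<in> Y\<rbrakk> \<Longrightarrow> \<phi> (inv_letter a) (\<phi> a y) = y"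
    and "set w \<subseteq> A" and y: "y \<in> Y"
  shows "foldr \<phi> (reduce_word w) y = foldr \<phi> w y"
  using \<open>set w \<subseteq> A\<close>
proof (induction w)
  case Nil
  show ?case by simp
next
  case (Cons a w)
  have foldr_closed: "foldr \<phi> u y \<in> Y" if "set u \<subseteq> A" for u
    using that by (induction u) (simp_all add: closed y)
  have "set (reduce_word w) \<subseteq> A"
    using Cons.prems set_reduce_word [of w] by auto
  then have "foldr \<phi> (cons_reduce a (reduce_word w)) y = \<phi> a (foldr \<phi> (reduce_word w) y)"
    by (cases "reduce_word w") (auto simp: cons_reduce_def cancel foldr_closed)
  also have "\<dots> = foldr \<phi> (a # w) y"
    using Cons by simp
  finally show ?case
    unfolding reduce_word_Cons .
qed

lemma reduce_word_append_reduce_left: "reduce_word (reduce_word u @ v) = reduce_word (u @ v)"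
  unfolding reduce_word_append
proof (rule foldr_reduce_word [where A = UNIV and Y = "{w. reduced_word w}"])
  show "cons_reduce (inv_letter a) (cons_reduce a w) = w" if "w \<in> {w. reduced_word w}" for a w
    using that cons_reduce_inv_letter [of w "inv_letter a"] by simp
qed (simp_all add: reduced_word_cons_reduce reduced_word_reduce_word)

lemma reduce_word_append_reduce_right: "reduce_word (u @ reduce_word v) = reduce_word (u @ v)"
  by (simp add: reduce_word_append reduce_word_reduced reduced_word_reduce_word)

lemma reduce_word_inverse_left: "reduce_word (rev (map inv_letter w) @ w) = []"
proof (induction w)
  case Nil
  show ?case by simp
next
  case (Cons a w)
  have "cons_reduce (inv_letter a) (cons_reduce a (reduce_word w)) = reduce_word w"
    using cons_reduce_inv_letter [OF reduced_word_reduce_word, of "inv_letter a"] by simp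
  then show ?case
    using Cons by (simp add: reduce_word_append reduce_word_Cons del: reduce_word.simps(2))
qed

lemma carrier_free_group: "carrier (free_group S) = {w. fst ` set w \<subseteq> S \<and> reduced_word w}"
  by (simp add: free_group_def)

lemma mult_free_group [simp]: "u \<otimes>\<^bsub>free_group S\<^esub> v = reduce_word (u @ v)"
  by (simp add: free_group_def)

lemma one_free_group [simp]: "\<one>\<^bsub>free_group S\<^esub> = []"
  by (simp add: free_group_def)

lemma reduce_word_in_free_group:
  assumes "fst ` set w \<subseteq> S"
  shows "reduce_word w \<in> carrier (free_group S)"
  using order_trans [OF image_mono [OF set_reduce_word] assms]
  by (simp add: carrier_free_group reduced_word_reduce_word)

lemma group_free_group: "group (free_group S)"
proof (rule groupI)
  fix u v assume "u \<in> carrier (free_group S)" "v \<in> carrier (free_group S)"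
  then show "u \<otimes>\<^bsub>free_group S\<^esub> v \<in> carrier (free_group S)"
    using reduce_word_in_free_group [of "u @ v" S] by (simp add: carrier_free_group image_Un)
next
  fix w assume "w \<in> carrier (free_group S)"
  then have "reduce_word (rev (map inv_letter w)) \<in> carrier (free_group S)"
    by (intro reduce_word_in_free_group) (auto simp: carrier_free_group inv_letter_def)
  moreover have "reduce_word (rev (map inv_letter w)) \<otimes>\<^bsub>free_group S\<^esub> w = \<one>\<^bsub>free_group S\<^esub>"
    by (simp add: reduce_word_append_reduce_left reduce_word_inverse_left)
  ultimately show "\<exists>v\<in>carrier (free_group S). v \<otimes>\<^bsub>free_group S\<^esub> w = \<one>\<^bsub>free_group S\<^esub>"
    by blast
qed (auto simp: carrier_free_group reduce_word_append_reduce_left reduce_word_append_reduce_right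
      reduce_word_reduced)

context group
begin

definition letter_mult :: "('c \<Rightarrow> 'a) \<Rightarrow> 'c \<times> bool \<Rightarrow> 'a \<Rightarrow> 'a" where
  "letter_mult f a y = (if snd a then f (fst a) else inv (f (fst a))) \<otimes> y"

lemma letter_mult_closed:
  assumes "f ` S \<subseteq> carrier G" "a \<in> S \<times> UNIV" "y \<in> carrier G"
  shows "letter_mult f a y \<in> carrier G"
  using assms by (auto simp: letter_mult_def)

lemma letter_mult_inv_letter:
  assumes "f ` S \<subseteq> carrier G" "a \<in> S \<times> UNIV" "y \<in> carrier G"
  shows "letter_mult f (inv_letter a) (letter_mult f a y) = y"
  using assms
  by (auto simp: letter_mult_def inv_letter_def m_assoc [symmetric] image_subset_iff)

lemma letter_mult_assoc:
  assumes "f ` S \<subseteq> carrier G" "a \<in> S \<times> UNIV" "y \<in> carrier G" "z \<in> carrier G"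
  shows "letter_mult f a (y \<otimes> z) = letter_mult f a y \<otimes> z"
  using assms by (auto simp: letter_mult_def m_assoc image_subset_iff)

definition word_value :: "('c \<Rightarrow> 'a) \<Rightarrow> ('c \<times> bool) list \<Rightarrow> 'a" where
  "word_value f w = foldr (letter_mult f) w \<one>"

lemma word_value_closed:
  assumes "f ` S \<subseteq> carrier G" "set w \<subseteq> S \<times> UNIV"
  shows "word_value f w \<in> carrier G"
  using assms(2) unfolding word_value_def
  by (induction w) (simp_all add: letter_mult_closed [OF assms(1)])

lemma foldr_letter_mult:
  assumes "f ` S \<subseteq> carrier G" "set w \<subseteq> S \<times> UNIV" "y \<in> carrier G"
  shows "foldr (letter_mult f) w y = word_value f w \<otimes> y"
  using assms(2)
proof (induction w)
  case Nil
  show ?case using assms(3) by (simp add: word_value_def)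
next
  case (Cons a w)
  have "foldr (letter_mult f) (a # w) y = letter_mult f a (word_value f w \<otimes> y)"
    using Cons by simp
  also have "\<dots> = letter_mult f a (word_value f w) \<otimes> y"
    using Cons.prems word_value_closed [OF assms(1)] assms(3)
    by (intro letter_mult_assoc [OF assms(1)]) auto
  finally show ?case
    by (simp add: word_value_def)
qed

lemma word_value_hom:
  assumes f: "f ` S \<subseteq> carrier G"
  shows "word_value f \<in> hom (free_group S) G"
proof (rule homI)
  fix u v assume "u \<in> carrier (free_group S)" "v \<in> carrier (free_group S)"
  then have letters: "set u \<subseteq> S \<times> UNIV" "set v \<subseteq> S \<times> UNIV"
    by (auto simp: carrier_free_group)
  then show "word_value f u \<in> carrier G"
    using f by (intro word_value_closed)
  have "word_value f (u \<otimes>\<^bsub>free_group S\<^esub> v) = foldr (letter_mult f) (u @ v) \<one>"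
    unfolding word_value_def mult_free_group
    by (rule foldr_reduce_word [where A = "S \<times> UNIV" and Y = "carrier G"])
       (use f letters in \<open>auto intro: letter_mult_closed letter_mult_inv_letter\<close>)
  also have "\<dots> = foldr (letter_mult f) u (word_value f v)"
    by (simp add: word_value_def)
  also have "\<dots> = word_value f u \<otimes> word_value f v"
    using f letters by (intro foldr_letter_mult word_value_closed)
  finally show "word_value f (u \<otimes>\<^bsub>free_group S\<^esub> v) = word_value f u \<otimes> word_value f v" .
qed

lemma free_group_universal:
  fixes f :: "'c \<Rightarrow> 'a"
  assumes f: "f ` S \<subseteq> carrier G"
  obtains h where "h \<in> hom (free_group S) G" "\<And>x. x \<in> S \<Longrightarrow> h [(x, True)] = f x"
proof
  show "word_value f \<in> hom (free_group S) G"
    using f by (rule word_value_hom)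
  show "word_value f [(x, True)] = f x" if "x \<in> S" for x
    using that f by (auto simp: word_value_def letter_mult_def)
qed

end

section \<open>Graev free groups\<close>

lemma F'_space_graev_free_topology_iff_P_space:
  assumes "completely_regular_space X"
  shows "F'_space (graev_free_topology X x0) \<longleftrightarrow> P_space X"
proof -
  interpret group_insertion "graev_free_group X x0" X "graev_ins x0"
    by (intro group_insertion.intro group_insertion_axioms.intro)
       (auto simp: graev_free_group_def group_free_group carrier_free_group graev_ins_def)
  have "\<exists>h\<in>hom (graev_free_group X x0) additive_group.
          \<forall>x\<in>topspace X - {x0}. h (graev_ins x0 x) = f x" for f :: "'a \<Rightarrow> real"
  proof -
    obtain h where "h \<in> hom (free_group (topspace X - {x0})) additive_group"
      "\<And>x. x \<in> topspace X - {x0} \<Longrightarrow> h [(x, True)] = f x"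
      by (rule group.free_group_universal [OF group_additive_group,
            of f "topspace X - {x0}"]) auto
    then show ?thesis
      unfolding graev_free_group_def by (intro bexI [of _ h]) (auto simp: graev_ins_def)
  qed
  then show ?thesis
    unfolding graev_free_topology_def using assms
    by (intro F'_space_finest_group_topology_iff_P_space)
       (auto simp: graev_ins_def graev_free_group_def)
qed

lemma F'_space_graev_free_ab_topology_iff_P_space:
  assumes "completely_regular_space X"
  shows "F'_space (graev_free_ab_topology X x0) \<longleftrightarrow> P_space X"
proof -
  interpret group_insertion "graev_free_ab_group X x0" X "graev_ab_ins x0"
    by (intro group_insertion.intro group_insertion_axioms.intro)
       (auto simp: graev_free_ab_group_def graev_ab_ins_def keys_frag_of)
  have "\<exists>h\<in>hom (graev_free_ab_group X x0) additive_group.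
          \<forall>x\<in>topspace X - {x0}. h (graev_ab_ins x0 x) = f x" for f :: "'a \<Rightarrow> real"
  proof -
    obtain h where "h \<in> hom (free_Abelian_group (topspace X - {x0})) additive_group"
      "\<And>x. x \<in> topspace X - {x0} \<Longrightarrow> h (frag_of x) = f x"
      by (rule comm_group.free_Abelian_group_universal [OF comm_group_additive_group,
            of f "topspace X - {x0}"]) auto
    then show ?thesis
      unfolding graev_free_ab_group_def by (intro bexI [of _ h]) (auto simp: graev_ab_ins_def)
  qed
  then show ?thesis
    unfolding graev_free_ab_topology_def using assms
    by (intro F'_space_finest_group_topology_iff_P_space)
       (auto simp: graev_ab_ins_def graev_free_ab_group_def)
qed

theorem theorem4:
  fixes X :: "'a topology" and x0 :: 'a
  assumes "tychonoff_space X" and "x0 \<in> topspace X"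
  shows "(F'_space (graev_free_topology X x0) \<longleftrightarrow> F'_space (graev_free_ab_topology X x0))
       \<and> (F'_space (graev_free_ab_topology X x0) \<longleftrightarrow> P_space X)"
proof -
  have "completely_regular_space X"
    using assms(1) by (simp add: tychonoff_space_def)
  then show ?thesis
    by (simp add: F'_space_graev_free_topology_iff_P_space F'_space_graev_free_ab_topology_iff_P_space)
qed

end
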